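(* Let $G=(V,E)$ be a directed graph with $|E|=m$ and players $i\in N=\{1,\dots,n\}$ with source-sink pairs $(s_i,t_i)$. Let the bandwidth utility functions $U_i$, $i\in N$, be non-decreasing, identical and linear, and assume that all players share the same source $s_i=s$, $i\in N$. Then, for the integral routing model with strategy spaces $X_i'=X_i\cap\mathbb{Z}^m_+$, every capacity vector $u\in\mathbb{Z}^m_+$ is weakly enforceable with market clearing prices.
   Context: The flow polyhedron of player $i$ is $X_i=\{x_i\in\mathbb{R}^m_+:\sum_{j\in\delta^+(v)}x_{ij}-\sum_{j\in\delta^-(v)}x_{ij}=0\ \text{for all }v\in V\setminus\{s_i,t_i\}\}$, where $s_i\ne t_i$ and $\delta^+(v),\delta^-(v)$ are the arcs leaving and entering $v$. The net flow value is $\mathrm{val}(x_i)=\sum_{j\in\delta^+(s_i)}x_{ij}-\sum_{j\in\delta^-(s_i)}x_{ij}$. Identical, non-decreasing and linear utilities means $U_i(z)=az$ for all $i\in N$ with a common $a\ge0$. Let $\ell(x)=\sum_{i\in N}x_i$. $u$ is weakly enforceable with market clearing prices if there are $x^*\in\prod_{i\in N}X_i'$ and $\lambda\in\mathbb{R}^m_+$ such that $\ell(x^* )\le u$, $\ell_j(x^* )<u_j\Rightarrow\lambda_j=0$ for all $j\in E$, and $x_i^*\in\arg\max\{U_i(\mathrm{val}(x_i))-\lambda^\intercal x_i:x_i\in X_i'\}$ for all $i\in N$. *)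

theory Defs
  imports Complex_Main "HOL-Library.FuncSet" "Graph_Theory.Digraph"
begin

text \<open>
  Vectors in \<open>\<real>\<^sup>m\<close> with \<open>m = card (arcs G)\<close> are extensional functions on \<open>arcs G\<close>,
  and profiles over \<open>N = {1..n}\<close> are extensional functions on \<open>{1..n}\<close>; so two vectors (profiles)
  are equal iff their components are. In a \<open>pre_digraph\<close> arcs have their own type, so parallel arcs
  and loops are allowed.
\<close>

definition flow_polyhedron :: "('v, 'e) pre_digraph \<Rightarrow> 'v \<Rightarrow> 'v \<Rightarrow> ('e \<Rightarrow> real) set" where
  "flow_polyhedron G s t =
     {x \<in> arcs G \<rightarrow>\<^sub>E {0..}.
        \<forall>v \<in> verts G - {s, t}. (\<Sum>j\<in>out_arcs G v. x j) - (\<Sum>j\<in>in_arcs G v. x j) = 0}"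

definition flow_value :: "('v, 'e) pre_digraph \<Rightarrow> 'v \<Rightarrow> ('e \<Rightarrow> real) \<Rightarrow> real" where
  "flow_value G s x = (\<Sum>j\<in>out_arcs G s. x j) - (\<Sum>j\<in>in_arcs G s. x j)"

definition integral_flows :: "('v, 'e) pre_digraph \<Rightarrow> 'v \<Rightarrow> 'v \<Rightarrow> ('e \<Rightarrow> real) set" where
  "integral_flows G s t = flow_polyhedron G s t \<inter> (arcs G \<rightarrow>\<^sub>E \<int>)"

definition load :: "nat \<Rightarrow> (nat \<Rightarrow> 'e \<Rightarrow> real) \<Rightarrow> 'e \<Rightarrow> real" where
  "load n x j = (\<Sum>i\<in>{1..n}. x i j)"

definition identical_nondecreasing_linear :: "nat \<Rightarrow> (nat \<Rightarrow> real \<Rightarrow> real) \<Rightarrow> bool" where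
  "identical_nondecreasing_linear n U \<longleftrightarrow> (\<exists>a\<ge>0. \<forall>i\<in>{1..n}. \<forall>z. U i z = a * z)"

definition weakly_enforceable_market_clearing ::
  "('v, 'e) pre_digraph \<Rightarrow> nat \<Rightarrow> (nat \<Rightarrow> 'v) \<Rightarrow> (nat \<Rightarrow> ('e \<Rightarrow> real) set)
    \<Rightarrow> (nat \<Rightarrow> real \<Rightarrow> real) \<Rightarrow> ('e \<Rightarrow> real) \<Rightarrow> bool" where
  "weakly_enforceable_market_clearing G n s X U u \<longleftrightarrow>
     (\<exists>x \<in> (\<Pi>\<^sub>E i\<in>{1..n}. X i). \<exists>p \<in> arcs G \<rightarrow>\<^sub>E {0..}.
        (\<forall>j\<in>arcs G. load n x j \<le> u j) \<and>
        (\<forall>j\<in>arcs G. load n x j < u j \<longrightarrow> p j = 0) \<and>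
        (\<forall>i\<in>{1..n}.
           is_arg_max (\<lambda>y. U i (flow_value G (s i) y) - (\<Sum>j\<in>arcs G. p j * y j))
             (\<lambda>y. y \<in> X i) (x i)))"

end

theory Submission imports Defs begin

text \<open>
  Adding up the players' flows gives a flow from the common source to the sinks, and every integral
  flow of this kind splits, up to circulations, into unit flows to the individual sinks. Route a
  maximum such flow and put the price \<open>a\<close> on every arc leaving a minimum cut \<open>S\<close>. Any flow of a
  player has to cross the cut, so its payoff is \<open>- a\<close> times the amount re-entering \<open>S\<close>, which is at
  most \<open>0\<close>; and a maximum flow never re-enters \<open>S\<close>.
\<close>

section \<open>Linearity of net flow and load\<close>

lemma flow_value_cong:
  "(\<And>j. j \<in> arcs G \<Longrightarrow> f j = g j) \<Longrightarrow> flow_value G v f = flow_value G v g"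
  unfolding flow_value_def by (intro arg_cong2[of _ _ _ _ "(-)"] sum.cong) auto

lemma flow_value_zero [simp]: "flow_value G v (\<lambda>j. 0) = 0"
  by (simp add: flow_value_def)

lemma flow_value_add:
  "flow_value G v (\<lambda>j. f j + g j) = flow_value G v f + flow_value G v g"
  by (simp add: flow_value_def sum.distrib)

lemma flow_value_diff:
  "flow_value G v (\<lambda>j. f j - g j) = flow_value G v f - flow_value G v g"
  by (simp add: flow_value_def sum_subtractf)

lemma load_fun_upd_add:
  assumes "i \<in> {1..n}"
  shows "load n (x(i := \<lambda>j. x i j + d j)) j = load n x j + d j"
proof -
  have "load n (x(i := \<lambda>j. x i j + d j)) j = (\<Sum>k\<in>{1..n}. x k j + (if k = i then d j else 0))"
    unfolding load_def by (intro sum.cong) auto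
  also have "\<dots> = load n x j + d j"
    using assms by (simp add: load_def sum.distrib)
  finally show ?thesis .
qed

lemma Ints_add_one_le:
  fixes a b :: real
  assumes "a \<in> \<int>" "b \<in> \<int>" "a < b"
  shows "a + 1 \<le> b"
  using assms by (auto elim!: Ints_cases)

text \<open>Flows are added and subtracted as total functions, whose values off the arcs do not
  matter; this equivalence leads back to the extensional vectors of the model.\<close>

lemma restrict_in_integral_flows_iff:
  "restrict x (arcs G) \<in> integral_flows G s t \<longleftrightarrow>
     (\<forall>j\<in>arcs G. x j \<in> \<int> \<and> 0 \<le> x j) \<and> (\<forall>v\<in>verts G - {s, t}. flow_value G v x = 0)"
proof -
  have "flow_value G v (restrict x (arcs G)) = flow_value G v x" for v
    by (intro flow_value_cong) simp
  then show ?thesis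
    unfolding integral_flows_def flow_polyhedron_def flow_value_def[symmetric]
    by (auto simp: PiE_iff)
qed

context fin_digraph
begin

section \<open>Net flow out of a vertex set\<close>

text \<open>Serves to extend a unit flow by one arc: its end moves from tail to head for
  \<open>c = 1\<close> and from head to tail for \<open>c = - 1\<close>. For a loop the two terms
  cancel.\<close>

lemma flow_value_single:
  assumes "e \<in> arcs G"
  shows "flow_value G v (\<lambda>j. c * of_bool (j = e)) =
    c * (of_bool (v = tail G e) - of_bool (v = head G e))"
proof -
  have *: "(\<Sum>j\<in>A. c * of_bool (j = e)) = c * of_bool (e \<in> A)" if "finite A" for A
    using that by (simp add: of_bool_def if_distrib[of "(*) c"] sum.delta cong: if_cong)
  show ?thesis
    using assms unfolding flow_value_def *[OF finite_out_arcs] *[OF finite_in_arcs]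
    by (auto simp: of_bool_def)
qed

text \<open>An arc with both ends in \<open>S\<close> is counted once at its tail and once, with
  opposite sign, at its head, so only arcs crossing the boundary of \<open>S\<close> remain.\<close>

lemma sum_flow_value_cut:
  assumes "finite S"
  shows "(\<Sum>v\<in>S. flow_value G v f) =
    sum f {e \<in> arcs G. tail G e \<in> S \<and> head G e \<notin> S} -
    sum f {e \<in> arcs G. head G e \<in> S \<and> tail G e \<notin> S}"
proof -
  have out: "(\<Sum>v\<in>S. sum f (out_arcs G v)) = sum f {e \<in> arcs G. tail G e \<in> S}"
    by (subst sum.UNION_disjoint[symmetric])
       (use assms in \<open>auto intro!: arg_cong2[of _ _ _ _ sum]\<close>)
  have inn: "(\<Sum>v\<in>S. sum f (in_arcs G v)) = sum f {e \<in> arcs G. head G e \<in> S}"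
    by (subst sum.UNION_disjoint[symmetric])
       (use assms in \<open>auto intro!: arg_cong2[of _ _ _ _ sum]\<close>)
  let ?I = "{e \<in> arcs G. tail G e \<in> S \<and> head G e \<in> S}"
  have "sum f {e \<in> arcs G. tail G e \<in> S} =
      sum f ?I + sum f {e \<in> arcs G. tail G e \<in> S \<and> head G e \<notin> S}"
    by (subst sum.union_disjoint[symmetric]) (auto intro!: arg_cong2[of _ _ _ _ sum])
  moreover have "sum f {e \<in> arcs G. head G e \<in> S} =
      sum f ?I + sum f {e \<in> arcs G. head G e \<in> S \<and> tail G e \<notin> S}"
    by (subst sum.union_disjoint[symmetric]) (auto intro!: arg_cong2[of _ _ _ _ sum])
  ultimately show ?thesis
    using out inn by (simp add: flow_value_def sum_subtractf)
qed

lemma sum_flow_value_verts: "(\<Sum>v\<in>verts G. flow_value G v f) = 0"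
proof -
  have "{e \<in> arcs G. tail G e \<in> verts G \<and> head G e \<notin> verts G} = {}"
    "{e \<in> arcs G. head G e \<in> verts G \<and> tail G e \<notin> verts G} = {}"
    by auto
  then show ?thesis
    by (simp only: sum_flow_value_cut finite_verts sum.empty diff_self)
qed

lemma flow_value_outside: "v \<notin> verts G \<Longrightarrow> flow_value G v f = 0"
proof -
  assume "v \<notin> verts G"
  then have "out_arcs G v = {}" "in_arcs G v = {}"
    by auto
  then show ?thesis
    by (simp add: flow_value_def)
qed

section \<open>Reachability by unit flows\<close>

text \<open>
  \<open>P\<close> and \<open>Q\<close> mark the arcs that may be used forwards and backwards. The set \<open>S\<close> is a largest set all
  of whose vertices are reached by unit flows staying inside it; an arc leaving such a set is not yet
  used by these flows, so it could be appended to one of them.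
\<close>

lemma unit_flows_to_closed_set:
  assumes s: "s \<in> verts G"
  obtains S where "S \<subseteq> verts G" "s \<in> S"
    "\<And>e. e \<in> arcs G \<Longrightarrow> P e \<Longrightarrow> tail G e \<in> S \<Longrightarrow> head G e \<in> S"
    "\<And>e. e \<in> arcs G \<Longrightarrow> Q e \<Longrightarrow> head G e \<in> S \<Longrightarrow> tail G e \<in> S"
    "\<And>t. t \<in> S \<Longrightarrow> \<exists>d. (\<forall>j. d j = 0 \<or> d j = 1 \<and> P j \<or> d j = - 1 \<and> Q j) \<and>
        (\<forall>v. flow_value G v d = of_bool (v = s) - of_bool (v = t))"
proof -
  define unit where "unit S t d \<longleftrightarrow>
      (\<forall>j. d j = 0 \<or> (j \<in> arcs G \<and> tail G j \<in> S \<and> head G j \<in> S \<and>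
        (d j = 1 \<and> P j \<or> d j = - 1 \<and> Q j))) \<and>
      (\<forall>v. flow_value G v d = of_bool (v = s) - of_bool (v = t))" for S t d
  define good where "good S \<longleftrightarrow> S \<subseteq> verts G \<and> s \<in> S \<and> (\<forall>t\<in>S. \<exists>d. unit S t d)" for S
  \<comment> \<open>The zero flow is a unit flow from \<open>s\<close> to itself because the two
    indicators cancel.\<close>
  have "unit {s} s (\<lambda>j. 0)"
    by (auto simp: unit_def)
  then have "good {s}"
    using s unfolding good_def by auto
  moreover have "\<forall>S. good S \<longrightarrow> card S < Suc (card (verts G))"
    by (auto simp: good_def less_Suc_eq_le intro: card_mono)
  ultimately obtain S where S: "good S" and max: "\<forall>S'. good S' \<longrightarrow> card S' \<le> card S"
    using ex_has_greatest_nat[of good "{s}" card] by metis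
  have fin: "finite S"
    using S finite_subset[OF _ finite_verts] by (simp add: good_def)
  \<comment> \<open>The number \<open>c\<close> is the direction in which \<open>e\<close> is
    traversed, from \<open>v\<close> to \<open>w\<close>; one argument thus gives both closure
    properties.\<close>
  have closed: "w \<in> S"
    if e: "e \<in> arcs G" and v: "v \<in> S" and w: "w \<in> verts G"
      and c: "c = 1 \<and> P e \<and> tail G e = v \<and> head G e = w \<or>
        c = - 1 \<and> Q e \<and> head G e = v \<and> tail G e = w"
    for e v w and c :: real
  proof (rule ccontr)
    assume nw: "w \<notin> S"
    have mono: "unit (insert w S) t d" if "unit S t d" for t d
      using that unfolding unit_def by blast
    obtain d where d: "unit S v d"
      using S v unfolding good_def by blast
    have "d e = 0"
      using d c nw unfolding unit_def by metis
    then have "unit (insert w S) w (\<lambda>j. d j + c * of_bool (j = e))"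
      using d e v c unfolding unit_def flow_value_add flow_value_single[OF e]
      by (auto simp: of_bool_def)
    then have "good (insert w S)"
      using S w mono unfolding good_def by blast
    then have "card (insert w S) \<le> card S"
      using max by blast
    then show False
      using nw fin by simp
  qed
  show ?thesis
  proof (rule that[of S])
    show "head G e \<in> S" if "e \<in> arcs G" "P e" "tail G e \<in> S" for e
      using closed[of e "tail G e" "head G e" 1] that by simp
    show "tail G e \<in> S" if "e \<in> arcs G" "Q e" "head G e \<in> S" for e
      using closed[of e "head G e" "tail G e" "- 1"] that by simp
    show "\<exists>d. (\<forall>j. d j = 0 \<or> d j = 1 \<and> P j \<or> d j = - 1 \<and> Q j) \<and>
        (\<forall>v. flow_value G v d = of_bool (v = s) - of_bool (v = t))" if t: "t \<in> S" for t
    proof -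
      obtain d where "unit S t d"
        using S t unfolding good_def by blast
      then show ?thesis
        unfolding unit_def by (intro exI[of _ d]) auto
    qed
  qed (use S in \<open>auto simp: good_def\<close>)
qed

section \<open>Splitting a flow among the players\<close>

text \<open>
  Equality of the net flows, and not of \<open>f\<close> and the load, is all that can be had without
  assigning the circulations in \<open>f\<close> to some player.
\<close>

lemma integral_flow_decomposition:
  assumes s: "s \<in> verts G"
    and f: "\<And>j. j \<in> arcs G \<Longrightarrow> f j \<in> \<int> \<and> 0 \<le> f j"
    and sink: "\<And>v. v \<in> verts G - {s} \<Longrightarrow> flow_value G v f \<le> 0"
    and inner: "\<And>v. v \<in> verts G - insert s (t ` {1..n}) \<Longrightarrow> flow_value G v f = 0"
    and ts: "\<And>i. i \<in> {1..n} \<Longrightarrow> t i \<in> verts G \<and> t i \<noteq> s"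
  shows "\<exists>x. (\<forall>i\<in>{1..n}. restrict (x i) (arcs G) \<in> integral_flows G s (t i)) \<and>
    (\<forall>j\<in>arcs G. load n x j \<le> f j) \<and>
    (\<forall>v. flow_value G v (load n x) = flow_value G v f)"
  using f sink inner
\<comment> \<open>The measure is the integral amount leaving \<open>s\<close>; it drops by one
  whenever a unit is handed to a player.\<close>
proof (induction "nat \<lfloor>flow_value G s f\<rfloor>" arbitrary: f rule: less_induct)
  case less
  have Ints: "flow_value G v f \<in> \<int>" for v
    unfolding flow_value_def using less.prems(1) by (intro Ints_diff Ints_sum) auto
  have total: "flow_value G s f = (\<Sum>v\<in>verts G - {s}. - flow_value G v f)"
    using sum_flow_value_verts[of f] sum.remove[OF finite_verts s, of "\<lambda>v. flow_value G v f"]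
    by (simp add: sum_negf)
  show ?case
  proof (cases "\<exists>i\<in>{1..n}. flow_value G (t i) f < 0")
    \<comment> \<open>No sink absorbs anything, so \<open>f\<close> is a circulation. It is dropped:
      zero flows for all players have the same net flows.\<close>
    case False
    then have zero: "flow_value G v f = 0" if "v \<in> verts G - {s}" for v
      using less.prems(2,3)[of v] that by (cases "v \<in> t ` {1..n}") force+
    then have "flow_value G v f = 0" for v
      using total flow_value_outside[of v f] by (cases "v \<in> verts G"; cases "v = s") auto
    moreover have "load n (\<lambda>i j. 0) = (\<lambda>j :: 'b. 0)"
      by (simp add: load_def fun_eq_iff)
    ultimately show ?thesis
      using less.prems(1)
      by (intro exI[of _ "\<lambda>i j. 0"]) (auto simp: restrict_in_integral_flows_iff)
  next
    case True
    then obtain i where i: "i \<in> {1..n}" and neg: "flow_value G (t i) f < 0"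
      by blast
    have ti: "t i \<in> verts G" "t i \<noteq> s"
      using ts i by auto
    \<comment> \<open>With backward use forbidden, \<open>d\<close> is a 0-1 flow supported where
      \<open>f\<close> is positive, so it can be subtracted from \<open>f\<close> and given to
      player \<open>i\<close> unchanged.\<close>
    obtain S where S: "S \<subseteq> verts G" "s \<in> S"
      "\<And>e. e \<in> arcs G \<Longrightarrow> f e > 0 \<Longrightarrow> tail G e \<in> S \<Longrightarrow> head G e \<in> S"
      "\<And>t. t \<in> S \<Longrightarrow> \<exists>d. (\<forall>j. d j = 0 \<or> d j = 1 \<and> f j > 0 \<or> d j = - 1 \<and> False) \<and>
        (\<forall>v. flow_value G v d = of_bool (v = s) - of_bool (v = t))"
      using unit_flows_to_closed_set[OF s, of "\<lambda>e. f e > 0" "\<lambda>_. False"] by metis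
    \<comment> \<open>Otherwise the complement of \<open>S\<close> absorbs a positive amount, which
      has to enter it on an arc from \<open>S\<close> with positive \<open>f\<close>, and
      \<open>S\<close> is closed under such arcs.\<close>
    have "t i \<in> S"
    proof (rule ccontr)
      assume nt: "t i \<notin> S"
      let ?W = "verts G - S"
      have "(\<Sum>v\<in>?W. flow_value G v f) < (\<Sum>v\<in>?W. 0)"
        using nt ti S(2) neg less.prems(2)
        by (intro sum_strict_mono_ex1) auto
      moreover have "sum f {e \<in> arcs G. head G e \<in> ?W \<and> tail G e \<notin> ?W} = 0"
        using S(3) less.prems(1) by (intro sum.neutral) force
      moreover have "sum f {e \<in> arcs G. tail G e \<in> ?W \<and> head G e \<notin> ?W} \<ge> 0"
        using less.prems(1) by (intro sum_nonneg) auto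
      ultimately show False
        by (simp add: sum_flow_value_cut)
    qed
    from S(4)[OF this] obtain d where
      d: "\<And>j. d j = 0 \<or> d j = 1 \<and> f j > 0" and
      val: "\<And>v. flow_value G v d = of_bool (v = s) - of_bool (v = t i)"
      by blast
    define g where "g = (\<lambda>j. f j - d j)"
    have g_val: "flow_value G v g = flow_value G v f - (of_bool (v = s) - of_bool (v = t i))" for v
      by (simp add: g_def flow_value_diff val)
    have pos: "flow_value G s f > 0"
      unfolding total using ti neg less.prems(2) by (intro sum_pos2[of _ "t i"]) auto
    have neg1: "flow_value G (t i) f + 1 \<le> 0"
      using Ints_add_one_le[OF Ints _ neg] by simp
    have "\<exists>x. (\<forall>i\<in>{1..n}. restrict (x i) (arcs G) \<in> integral_flows G s (t i)) \<and>
        (\<forall>j\<in>arcs G. load n x j \<le> g j) \<and>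
        (\<forall>v. flow_value G v (load n x) = flow_value G v g)"
    proof (rule less.hyps)
      have "1 \<le> flow_value G s f"
        using Ints_add_one_le[OF _ Ints pos] by simp
      then show "nat \<lfloor>flow_value G s g\<rfloor> < nat \<lfloor>flow_value G s f\<rfloor>"
        using ti by (simp add: g_val)
      show "g j \<in> \<int> \<and> 0 \<le> g j" if "j \<in> arcs G" for j
        using d[of j] less.prems(1)[OF that] Ints_add_one_le[of 0 "f j"]
        by (auto simp: g_def)
      show "flow_value G v g \<le> 0" if "v \<in> verts G - {s}" for v
        using less.prems(2)[OF that] neg1 that by (auto simp: g_val)
      show "flow_value G v g = 0" if "v \<in> verts G - insert s (t ` {1..n})" for v
        using less.prems(3)[OF that] i that by (auto simp: g_val)
    qed
    then obtain x where
      x: "\<And>k. k \<in> {1..n} \<Longrightarrow> restrict (x k) (arcs G) \<in> integral_flows G s (t k)" and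
      le: "\<And>j. j \<in> arcs G \<Longrightarrow> load n x j \<le> g j" and
      eq: "\<And>v. flow_value G v (load n x) = flow_value G v g"
      by blast
    let ?x = "x(i := \<lambda>j. x i j + d j)"
    have "d j \<in> \<int> \<and> 0 \<le> d j" for j
      using d[of j] by auto
    then have "restrict (?x k) (arcs G) \<in> integral_flows G s (t k)" if "k \<in> {1..n}" for k
      using x[OF that] unfolding restrict_in_integral_flows_iff
      by (auto simp: flow_value_add val)
    moreover have "load n ?x j \<le> f j" if "j \<in> arcs G" for j
      unfolding load_fun_upd_add[OF i] using le[OF that] by (simp add: g_def)
    moreover have "flow_value G v (load n ?x) = flow_value G v f" for v
    proof -
      have "load n ?x = (\<lambda>j. load n x j + d j)"
        by (rule ext) (rule load_fun_upd_add[OF i])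
      then show ?thesis
        by (simp add: flow_value_add eq g_val val)
    qed
    ultimately show ?thesis
      by blast
  qed
qed

section \<open>Maximum flow and minimum cut\<close>

text \<open>A maximum flow is split among the players, and \<open>S\<close> is the set reachable
  from \<open>s\<close> in the residual network of the resulting load. A sink in \<open>S\<close>
  would permit an augmentation; closedness of \<open>S\<close> makes leaving arcs full and entering
  arcs empty.\<close>

lemma max_flow_profile_with_min_cut:
  fixes u :: "'b \<Rightarrow> real"
  assumes s: "s \<in> verts G"
    and u: "\<And>j. j \<in> arcs G \<Longrightarrow> u j \<in> \<int> \<and> 0 \<le> u j"
    and ts: "\<And>i. i \<in> {1..n} \<Longrightarrow> t i \<in> verts G \<and> t i \<noteq> s"
  obtains x S where "\<And>i. i \<in> {1..n} \<Longrightarrow> restrict (x i) (arcs G) \<in> integral_flows G s (t i)"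
    "\<And>j. j \<in> arcs G \<Longrightarrow> load n x j \<le> u j"
    "S \<subseteq> verts G" "s \<in> S" "\<And>i. i \<in> {1..n} \<Longrightarrow> t i \<notin> S"
    "\<And>j. j \<in> arcs G \<Longrightarrow> tail G j \<in> S \<Longrightarrow> head G j \<notin> S \<Longrightarrow> load n x j = u j"
    "\<And>j. j \<in> arcs G \<Longrightarrow> head G j \<in> S \<Longrightarrow> tail G j \<notin> S \<Longrightarrow> load n x j = 0"
proof -
  \<comment> \<open>The sinks are pooled into a single-commodity problem. The sign condition
    replaces a super sink: how much each sink absorbs is left open.\<close>
  define feasible where "feasible f \<longleftrightarrow>
      (\<forall>j\<in>arcs G. f j \<in> \<int> \<and> 0 \<le> f j \<and> f j \<le> u j) \<and>
      (\<forall>v\<in>verts G - {s}. flow_value G v f \<le> 0) \<and>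
      (\<forall>v\<in>verts G - insert s (t ` {1..n}). flow_value G v f = 0)" for f
  define val where "val f = nat \<lfloor>flow_value G s f\<rfloor>" for f
  have "feasible (\<lambda>j. 0)"
    using u by (auto simp: feasible_def)
  \<comment> \<open>A bounded natural-number objective has a maximizer, even though feasible
    functions are arbitrary off the arcs and need not form a finite set.\<close>
  moreover have "\<forall>f. feasible f \<longrightarrow> val f < Suc (nat \<lfloor>sum u (arcs G)\<rfloor>)"
  proof (intro allI impI)
    fix f assume f: "feasible f"
    have "0 \<le> sum f (in_arcs G s)"
      using f unfolding feasible_def by (intro sum_nonneg) auto
    then have "flow_value G s f \<le> sum f (out_arcs G s)"
      by (simp add: flow_value_def)
    also have "\<dots> \<le> sum u (out_arcs G s)"
      using f unfolding feasible_def by (intro sum_mono) auto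
    also have "\<dots> \<le> sum u (arcs G)"
      using u by (intro sum_mono2) auto
    finally show "val f < Suc (nat \<lfloor>sum u (arcs G)\<rfloor>)"
      unfolding val_def less_Suc_eq_le by (intro nat_mono floor_mono)
  qed
  ultimately obtain f where f: "feasible f" and max: "\<forall>g. feasible g \<longrightarrow> val g \<le> val f"
    using ex_has_greatest_nat[of feasible "\<lambda>j. 0" val] by metis
  obtain x where
    x: "\<And>i. i \<in> {1..n} \<Longrightarrow> restrict (x i) (arcs G) \<in> integral_flows G s (t i)" and
    le: "\<And>j. j \<in> arcs G \<Longrightarrow> load n x j \<le> f j" and
    eq: "\<And>v. flow_value G v (load n x) = flow_value G v f"
    using integral_flow_decomposition[OF s, of f t n] f ts unfolding feasible_def by metis
  \<comment> \<open>On the arcs, \<open>f\<close> may exceed the load by a circulation. Having the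
    same net flows, the load is itself a maximum flow, and its residual network concerns what the
    players really use.\<close>
  define g where "g = load n x"
  have xi: "x i j \<in> \<int>" "0 \<le> x i j" if "i \<in> {1..n}" "j \<in> arcs G" for i j
    using x[OF that(1)] that(2) by (auto simp: restrict_in_integral_flows_iff)
  have g: "g j \<in> \<int>" "0 \<le> g j" "g j \<le> u j" if "j \<in> arcs G" for j
  proof -
    show "g j \<in> \<int>" "0 \<le> g j"
      unfolding g_def load_def using xi that by (auto intro: Ints_sum sum_nonneg)
    have "f j \<le> u j"
      using f that by (simp add: feasible_def)
    then show "g j \<le> u j"
      using le[OF that] by (simp add: g_def)
  qed
  have g_val: "flow_value G v g = flow_value G v f" for v
    by (simp add: g_def eq)
  obtain S where S: "S \<subseteq> verts G" "s \<in> S"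
    "\<And>e. e \<in> arcs G \<Longrightarrow> g e < u e \<Longrightarrow> tail G e \<in> S \<Longrightarrow> head G e \<in> S"
    "\<And>e. e \<in> arcs G \<Longrightarrow> 0 < g e \<Longrightarrow> head G e \<in> S \<Longrightarrow> tail G e \<in> S"
    "\<And>t. t \<in> S \<Longrightarrow> \<exists>d. (\<forall>j. d j = 0 \<or> d j = 1 \<and> g j < u j \<or> d j = - 1 \<and> 0 < g j) \<and>
        (\<forall>v. flow_value G v d = of_bool (v = s) - of_bool (v = t))"
  proof (rule unit_flows_to_closed_set[OF s, of "\<lambda>e. g e < u e" "\<lambda>e. 0 < g e"], goal_cases)
    case (1 S)
    show ?case
      by (rule 1(1)) (fact 1(2-))+
  qed
  have "t i \<notin> S" if i: "i \<in> {1..n}" for i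
  proof
    assume "t i \<in> S"
    from S(5)[OF this] obtain d where
      d: "\<And>j. d j = 0 \<or> d j = 1 \<and> g j < u j \<or> d j = - 1 \<and> 0 < g j" and
      dv: "\<And>v. flow_value G v d = of_bool (v = s) - of_bool (v = t i)"
      by (elim exE conjE) (rule that; erule spec)
    have hv: "flow_value G v (\<lambda>j. g j + d j) =
        flow_value G v f + (of_bool (v = s) - of_bool (v = t i))" for v
      by (simp add: flow_value_add g_val dv)
    \<comment> \<open>By integrality, positive slack and positive load are at least 1, which leaves
      room for a unit change.\<close>
    have "g j + d j \<in> \<int> \<and> 0 \<le> g j + d j \<and> g j + d j \<le> u j" if "j \<in> arcs G" for j
      using d[of j] g[OF that] u[OF that] Ints_add_one_le[of "g j" "u j"]
        Ints_add_one_le[of 0 "g j"] by auto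
    moreover have "flow_value G v (\<lambda>j. g j + d j) \<le> 0" if v: "v \<in> verts G - {s}" for v
    proof -
      have "flow_value G v f \<le> 0"
        using f v by (simp add: feasible_def)
      then show ?thesis
        using v by (cases "v = t i") (auto simp: hv)
    qed
    moreover have "flow_value G v (\<lambda>j. g j + d j) = 0"
      if v: "v \<in> verts G - insert s (t ` {1..n})" for v
    proof -
      have "v \<noteq> t i" "v \<noteq> s" "flow_value G v f = 0"
        using f v i by (auto simp: feasible_def)
      then show ?thesis
        by (simp add: hv)
    qed
    ultimately have "feasible (\<lambda>j. g j + d j)"
      unfolding feasible_def by blast
    then have "val (\<lambda>j. g j + d j) \<le> val f"
      using max by blast
    then have "nat \<lfloor>flow_value G s f + 1\<rfloor> \<le> nat \<lfloor>flow_value G s f\<rfloor>"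
      using ts[OF i, THEN conjunct2, symmetric] by (simp add: val_def hv)
    \<comment> \<open>Needed since \<open>nat\<close> sends all negative values to 0 and could hide
      the increase by one.\<close>
    moreover have "flow_value G s f \<ge> 0"
    proof -
      have "flow_value G s f = - (\<Sum>v\<in>verts G - {s}. flow_value G v f)"
        using sum_flow_value_verts[of f] sum.remove[OF finite_verts s, of "\<lambda>v. flow_value G v f"]
        by simp
      moreover have "(\<Sum>v\<in>verts G - {s}. flow_value G v f) \<le> 0"
        using f by (intro sum_nonpos) (auto simp: feasible_def)
      ultimately show ?thesis
        by simp
    qed
    ultimately show False
      by linarith
  qed
  moreover have "g j = u j" if "j \<in> arcs G" "tail G j \<in> S" "head G j \<notin> S" for j
    using S(3)[of j] g(3)[of j] that by force
  moreover have "g j = 0" if "j \<in> arcs G" "head G j \<in> S" "tail G j \<notin> S" for j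
    using S(4)[of j] g(2)[of j] that by force
  ultimately show ?thesis
    using that[of x S] x g(3) S(1,2) unfolding g_def by blast
qed

section \<open>Prices supported on the cut\<close>

text \<open>As \<open>t\<close> lies outside \<open>S\<close>, only \<open>s\<close> can have
  nonzero net flow in \<open>S\<close>, so the value of \<open>y\<close> is what leaves
  \<open>S\<close> minus what re-enters. The price takes back exactly the utility of what
  leaves.\<close>

lemma payoff_under_cut_price:
  assumes y: "y \<in> integral_flows G s t"
    and S: "S \<subseteq> verts G" "s \<in> S" "t \<notin> S"
  shows "a * flow_value G s y
      - (\<Sum>j\<in>arcs G. (if tail G j \<in> S \<and> head G j \<notin> S then a else 0) * y j) =
    - a * sum y {j \<in> arcs G. head G j \<in> S \<and> tail G j \<notin> S}"
proof -
  have fin: "finite S"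
    using S(1) finite_verts by (rule finite_subset)
  have "flow_value G v y = 0" if "v \<in> verts G - {s, t}" for v
    using y that by (simp add: integral_flows_def flow_polyhedron_def flow_value_def)
  then have "(\<Sum>v\<in>S - {s}. flow_value G v y) = 0"
    using S by (intro sum.neutral) auto
  then have "flow_value G s y = (\<Sum>v\<in>S. flow_value G v y)"
    using sum.remove[OF fin S(2), of "\<lambda>v. flow_value G v y"] by simp
  moreover have "(\<Sum>j\<in>arcs G. (if tail G j \<in> S \<and> head G j \<notin> S then a else 0) * y j) =
      a * sum y {j \<in> arcs G. tail G j \<in> S \<and> head G j \<notin> S}"
    by (auto simp: sum_distrib_left sum.inter_filter intro!: sum.cong)
  ultimately show ?thesis
    by (simp add: sum_flow_value_cut[OF fin] right_diff_distrib)
qed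

end

theorem corollary9p2:
  fixes G :: "('v, 'e) pre_digraph"
    and n :: nat
    and s t :: "nat \<Rightarrow> 'v"
    and s0 :: 'v
    and U :: "nat \<Rightarrow> real \<Rightarrow> real"
    and u :: "'e \<Rightarrow> real"
  assumes "fin_digraph G"
    and "\<And>i. i \<in> {1..n} \<Longrightarrow> s i \<in> verts G \<and> t i \<in> verts G \<and> s i \<noteq> t i"
    and "identical_nondecreasing_linear n U"
    and "\<And>i. i \<in> {1..n} \<Longrightarrow> s i = s0"
    and "u \<in> arcs G \<rightarrow>\<^sub>E (\<int> \<inter> {0..})"
  shows "weakly_enforceable_market_clearing G n s (\<lambda>i. integral_flows G (s i) (t i)) U u"
proof (cases "n = 0")
  case True
  then show ?thesis
    using assms(5) unfolding weakly_enforceable_market_clearing_def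
    by (auto simp: load_def PiE_iff intro!: bexI[of _ "restrict (\<lambda>j. 0) (arcs G)"])
next
  case False
  interpret fin_digraph G by fact
  have s0: "s0 \<in> verts G"
    using assms(2,4)[of 1] False by simp
  have ts: "t i \<in> verts G \<and> t i \<noteq> s0" if "i \<in> {1..n}" for i
    using assms(2,4)[OF that] by auto
  have u: "u j \<in> \<int> \<and> 0 \<le> u j" if "j \<in> arcs G" for j
    using assms(5) that by (auto simp: PiE_iff)
  obtain a where a: "a \<ge> 0" and U: "\<And>i z. i \<in> {1..n} \<Longrightarrow> U i z = a * z"
    using assms(3) unfolding identical_nondecreasing_linear_def by blast
  obtain x S where x: "\<And>i. i \<in> {1..n} \<Longrightarrow> restrict (x i) (arcs G) \<in> integral_flows G s0 (t i)"
    and le: "\<And>j. j \<in> arcs G \<Longrightarrow> load n x j \<le> u j"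
    and S: "S \<subseteq> verts G" "s0 \<in> S" "\<And>i. i \<in> {1..n} \<Longrightarrow> t i \<notin> S"
    and out: "\<And>j. j \<in> arcs G \<Longrightarrow> tail G j \<in> S \<Longrightarrow> head G j \<notin> S \<Longrightarrow> load n x j = u j"
    and inn: "\<And>j. j \<in> arcs G \<Longrightarrow> head G j \<in> S \<Longrightarrow> tail G j \<notin> S \<Longrightarrow> load n x j = 0"
    using max_flow_profile_with_min_cut[where u = u and t = t and n = n, OF s0 u ts] by blast
  define X where "X = restrict (\<lambda>i. restrict (x i) (arcs G)) {1..n}"
  define p where
    "p = restrict (\<lambda>j. if tail G j \<in> S \<and> head G j \<notin> S then a else 0) (arcs G)"
  let ?In = "{j \<in> arcs G. head G j \<in> S \<and> tail G j \<notin> S}"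
  have load: "load n X j = load n x j" if "j \<in> arcs G" for j
    unfolding load_def X_def using that by (intro sum.cong) auto
  have payoff: "U i (flow_value G (s i) y) - (\<Sum>j\<in>arcs G. p j * y j) = - a * sum y ?In"
    if "i \<in> {1..n}" "y \<in> integral_flows G s0 (t i)" for i y
  proof -
    have "(\<Sum>j\<in>arcs G. p j * y j) =
        (\<Sum>j\<in>arcs G. (if tail G j \<in> S \<and> head G j \<notin> S then a else 0) * y j)"
      unfolding p_def by (intro sum.cong) auto
    then show ?thesis
      using payoff_under_cut_price[OF that(2) S(1,2) S(3)[OF that(1)], of a] assms(4) U that(1)
      by simp
  qed
  have "is_arg_max (\<lambda>y. U i (flow_value G (s i) y) - (\<Sum>j\<in>arcs G. p j * y j))
      (\<lambda>y. y \<in> integral_flows G (s i) (t i)) (X i)" if i: "i \<in> {1..n}" for i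
  proof -
    have Xi: "X i \<in> integral_flows G s0 (t i)"
      using x i by (simp add: X_def)
    \<comment> \<open>The total load on an entering arc is 0 and the players' flows are nonnegative,
      so each of them vanishes there.\<close>
    have "X i j = 0" if j: "j \<in> ?In" for j
    proof -
      have "(\<Sum>k\<in>{1..n}. x k j) = 0"
        using inn[of j] j by (simp add: load_def)
      moreover have "\<And>k. k \<in> {1..n} \<Longrightarrow> 0 \<le> x k j"
        using x j by (auto simp: restrict_in_integral_flows_iff)
      ultimately have "x i j = 0"
        using i by (subst (asm) sum_nonneg_eq_0_iff) auto
      then show ?thesis
        using i j by (simp add: X_def)
    qed
    then have "sum (X i) ?In = 0"
      by (intro sum.neutral) blast
    moreover have "0 \<le> a * sum y ?In" if "y \<in> integral_flows G s0 (t i)" for y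
      using that a by (intro mult_nonneg_nonneg sum_nonneg)
        (auto simp: integral_flows_def flow_polyhedron_def PiE_iff)
    ultimately show ?thesis
      using payoff[OF i] Xi assms(4)[OF i] by (force simp: is_arg_max_def)
  qed
  moreover have "X \<in> (\<Pi>\<^sub>E i\<in>{1..n}. integral_flows G (s i) (t i))"
    using x assms(4) by (auto simp: X_def PiE_iff)
  moreover have "p \<in> arcs G \<rightarrow>\<^sub>E {0..}"
    using a by (auto simp: p_def PiE_iff)
  moreover have "\<forall>j\<in>arcs G. load n X j \<le> u j"
    using le load by simp
  moreover have "\<forall>j\<in>arcs G. load n X j < u j \<longrightarrow> p j = 0"
    using out load by (auto simp: p_def)
  ultimately show ?thesis
    unfolding weakly_enforceable_market_clearing_def by blast
qed

end
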